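(* Consider the group $U(1)$ of unit-norm complex numbers under multiplication, and let $\Psi_1$ be the list consisting of the single frequency $\rho:e^{i\theta}\mapsto e^{i\theta}$. For any $0\le\lambda<1$, $\mathrm{GSynch}_n(\lambda,U(1),\Psi_1)$ is contiguous to $\mathrm{GSynch}_n(0,U(1),\Psi_1)$.
   Context: The Gaussian synchronization model in this case: $\mathrm{GSynch}_n(\lambda,U(1),\Psi_1)$ is the law of the $n\times n$ Hermitian matrix $$Y=\frac\lambda n xx^*+\frac1{\sqrt n}W,$$ where $x\in\mathbb{C}^n$ has independent coordinates, each uniformly distributed on the unit circle, $x^*$ is the conjugate transpose, and, independently of $x$, $W$ is an $n\times n$ GUE matrix: random Hermitian, with off-diagonal entries distributed as $\mathcal{N}(0,1/2)+\mathcal{N}(0,1/2)\,i$ (independent real and imaginary parts) and diagonal entries real $\mathcal{N}(0,1)$, all entries independent except for the Hermitian constraint. Contiguity: for sequences of probability measures $P_n,Q_n$ on measurable spaces $(\Omega_n,\mathcal{F}_n)$, $P_n$ is contiguous to $Q_n$ if for every sequence of events $A_n\in\mathcal{F}_n$, $Q_n(A_n)\to0$ implies $P_n(A_n)\to0$ as $n\to\infty$. *)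

theory Defs
  imports "HOL-Probability.Probability"
begin

text \<open>An \<open>n \<times> n\<close> complex matrix is a function on \<open>{..<n} \<times> {..<n}\<close> that is
  \<open>undefined\<close> elsewhere; the space of all of them carries its Borel (= product)
  \<open>\<sigma>\<close>-algebra.\<close>

type_synonym cmatrix = "nat \<times> nat \<Rightarrow> complex"

definition matrix_space :: "nat \<Rightarrow> cmatrix measure" where
  "matrix_space n = (\<Pi>\<^sub>M p\<in>{..<n} \<times> {..<n}. borel)"

definition circle_uniform :: "complex measure" where
  "circle_uniform = distr (uniform_measure lborel {0..2 * pi}) borel cis"

text \<open>The second argument of \<^const>\<open>normal_density\<close> is the standard deviation,
  not the variance.\<close>

definition normal_law :: "real \<Rightarrow> real measure" where
  "normal_law v = density lborel (\<lambda>x. ennreal (normal_density 0 (sqrt v) x))"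

definition gue_entry :: "nat \<times> nat \<Rightarrow> complex measure" where
  "gue_entry = (\<lambda>(i, j).
     if i = j then distr (normal_law 1) borel complex_of_real
     else distr (normal_law (1/2) \<Otimes>\<^sub>M normal_law (1/2)) borel (\<lambda>(a, b). Complex a b))"

definition upper_indices :: "nat \<Rightarrow> (nat \<times> nat) set" where
  "upper_indices n = {(i, j). i \<le> j \<and> j < n}"

definition hermitian_of_upper :: "nat \<Rightarrow> cmatrix \<Rightarrow> cmatrix" where
  "hermitian_of_upper n w =
     (\<lambda>(i, j)\<in>{..<n} \<times> {..<n}. if i \<le> j then w (i, j) else cnj (w (j, i)))"

definition GUE :: "nat \<Rightarrow> cmatrix measure" where
  "GUE n = distr (\<Pi>\<^sub>M p\<in>upper_indices n. gue_entry p) (matrix_space n) (hermitian_of_upper n)"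

definition synch_matrix :: "real \<Rightarrow> nat \<Rightarrow> (nat \<Rightarrow> complex) \<Rightarrow> cmatrix \<Rightarrow> cmatrix" where
  "synch_matrix l n x W =
     (\<lambda>(i, j)\<in>{..<n} \<times> {..<n}.
        of_real (l / real n) * (x i * cnj (x j)) + of_real (1 / sqrt (real n)) * W (i, j))"

definition GSynch_U1 :: "real \<Rightarrow> nat \<Rightarrow> cmatrix measure" where
  "GSynch_U1 l n =
     distr ((\<Pi>\<^sub>M i\<in>{..<n}. circle_uniform) \<Otimes>\<^sub>M GUE n) (matrix_space n)
       (\<lambda>(x, W). synch_matrix l n x W)"

definition contiguous :: "(nat \<Rightarrow> 'a measure) \<Rightarrow> (nat \<Rightarrow> 'a measure) \<Rightarrow> bool" where
  "contiguous P Q \<longleftrightarrow>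
     (\<forall>n. prob_space (P n) \<and> prob_space (Q n) \<and> sets (P n) = sets (Q n)) \<and>
     (\<forall>A. (\<forall>n. A n \<in> sets (Q n)) \<longrightarrow>
        (\<lambda>n. measure (Q n) (A n)) \<longlonglongrightarrow> 0 \<longrightarrow> (\<lambda>n. measure (P n) (A n)) \<longlonglongrightarrow> 0)"

text \<open>\<^const>\<open>distr\<close> degenerates to the null measure when the map is not measurable; the
  following facts rule this out for the laws above.\<close>

lemma measurable_cis: "cis \<in> borel_measurable borel"
  by (intro borel_measurable_continuous_onI continuous_intros)

lemma measurable_Complex: "(\<lambda>(a, b). Complex a b) \<in> borel_measurable (borel \<Otimes>\<^sub>M borel)"
proof -
  have "(\<lambda>p :: real \<times> real. complex_of_real (fst p) + \<i> * complex_of_real (snd p))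
      \<in> borel_measurable (borel \<Otimes>\<^sub>M borel)"
    by measurable
  then show ?thesis by (simp add: case_prod_beta' Complex_eq)
qed

lemma sets_circle_uniform [simp, measurable_cong]: "sets circle_uniform = sets borel"
  by (simp add: circle_uniform_def)

lemma prob_space_circle_uniform: "prob_space circle_uniform"
  unfolding circle_uniform_def
  by (intro prob_space.prob_space_distr prob_space_uniform_measure)
     (simp_all add: measurable_cis measurable_cong_sets[OF sets_uniform_measure refl])

lemma sets_normal_law [simp, measurable_cong]: "sets (normal_law v) = sets borel"
  by (simp add: normal_law_def)

lemma prob_space_normal_law: "v > 0 \<Longrightarrow> prob_space (normal_law v)"
  unfolding normal_law_def by (rule prob_space_normal_density) simp

lemma sets_gue_entry [simp, measurable_cong]: "sets (gue_entry p) = sets borel"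
  by (simp add: gue_entry_def case_prod_beta')

lemma prob_space_gue_entry: "prob_space (gue_entry p)"
proof -
  interpret N: prob_space "normal_law (1/2)" by (rule prob_space_normal_law) simp
  interpret NN: pair_prob_space "normal_law (1/2)" "normal_law (1/2)" ..
  have s: "sets (normal_law (1/2) \<Otimes>\<^sub>M normal_law (1/2)) = sets (borel \<Otimes>\<^sub>M borel)"
    by (intro sets_pair_measure_cong) simp_all
  have "(\<lambda>(a, b). Complex a b) \<in> borel_measurable (normal_law (1/2) \<Otimes>\<^sub>M normal_law (1/2))"
    using measurable_Complex measurable_cong_sets[OF s refl] by blast
  moreover have "complex_of_real \<in> borel_measurable (normal_law 1)" by measurable
  ultimately show ?thesis
    by (auto simp: gue_entry_def case_prod_beta' split: if_splits
        intro!: prob_space.prob_space_distr prob_space_normal_law NN.prob_space_axioms)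
qed

lemma measurable_hermitian_of_upper:
  "hermitian_of_upper n \<in> (\<Pi>\<^sub>M p\<in>upper_indices n. gue_entry p) \<rightarrow>\<^sub>M matrix_space n"
proof -
  let ?M = "\<Pi>\<^sub>M p\<in>upper_indices n. gue_entry p"
  have c: "(\<lambda>w. w p) \<in> borel_measurable ?M" if "p \<in> upper_indices n" for p
    using measurable_component_singleton[OF that, of gue_entry]
      measurable_cong_sets[OF refl sets_gue_entry] by blast
  have d: "(\<lambda>w. cnj (w p)) \<in> borel_measurable ?M" if "p \<in> upper_indices n" for p
    by (rule measurable_compose[OF c[OF that]])
       (intro borel_measurable_continuous_onI continuous_intros)
  show ?thesis
    unfolding hermitian_of_upper_def matrix_space_def
  proof (rule measurable_restrict, goal_cases)
    case (1 p)
    then obtain i j where p: "p = (i, j)" "i < n" "j < n" by auto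
    then have "i \<le> j \<Longrightarrow> (i, j) \<in> upper_indices n" "\<not> i \<le> j \<Longrightarrow> (j, i) \<in> upper_indices n"
      by (auto simp: upper_indices_def)
    then show ?case
      by (cases "i \<le> j") (simp_all add: c d p)
  qed
qed

lemma sets_GUE [simp, measurable_cong]: "sets (GUE n) = sets (matrix_space n)"
  by (simp add: GUE_def)

lemma prob_space_GUE: "prob_space (GUE n)"
  unfolding GUE_def
  by (intro prob_space.prob_space_distr prob_space_PiM prob_space_gue_entry
      measurable_hermitian_of_upper)

lemma measurable_synch_matrix:
  "(\<lambda>(x, W). synch_matrix l n x W)
     \<in> (\<Pi>\<^sub>M i\<in>{..<n}. circle_uniform) \<Otimes>\<^sub>M GUE n \<rightarrow>\<^sub>M matrix_space n"
proof -
  let ?M = "(\<Pi>\<^sub>M i\<in>{..<n}. circle_uniform) \<Otimes>\<^sub>M GUE n"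
  have x: "(\<lambda>z. fst z i) \<in> borel_measurable ?M" if "i < n" for i
    using measurable_compose[OF measurable_fst measurable_component_singleton[of i "{..<n}"]] that
      measurable_cong_sets[OF refl sets_circle_uniform] by blast
  have cx: "(\<lambda>z. cnj (fst z i)) \<in> borel_measurable ?M" if "i < n" for i
    by (rule measurable_compose[OF x[OF that]])
       (intro borel_measurable_continuous_onI continuous_intros)
  have s: "snd \<in> ?M \<rightarrow>\<^sub>M (\<Pi>\<^sub>M p\<in>{..<n} \<times> {..<n}. borel)"
    using measurable_snd[of "\<Pi>\<^sub>M i\<in>{..<n}. circle_uniform" "GUE n"]
      measurable_cong_sets[OF refl sets_GUE] unfolding matrix_space_def by blast
  have w: "(\<lambda>z. snd z (i, j)) \<in> borel_measurable ?M" if "i < n" "j < n" for i j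
    by (rule measurable_compose[OF s measurable_component_singleton]) (use that in auto)
  show ?thesis
    unfolding synch_matrix_def matrix_space_def case_prod_beta'
  proof (rule measurable_restrict, goal_cases)
    case (1 p)
    then obtain i j where p: "p = (i, j)" "i < n" "j < n" by auto
    then have [measurable]: "(\<lambda>z. fst z i) \<in> borel_measurable ?M"
        "(\<lambda>z. cnj (fst z j)) \<in> borel_measurable ?M"
        "(\<lambda>z. snd z (i, j)) \<in> borel_measurable ?M"
      by (simp_all add: x cx w)
    show ?case
      unfolding p fst_conv snd_conv by measurable
  qed
qed

lemma sets_GSynch_U1 [simp, measurable_cong]: "sets (GSynch_U1 l n) = sets (matrix_space n)"
  by (simp add: GSynch_U1_def)

lemma prob_space_GSynch_U1: "prob_space (GSynch_U1 l n)"
proof -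
  interpret X: prob_space "\<Pi>\<^sub>M i\<in>{..<n}. circle_uniform"
    by (intro prob_space_PiM prob_space_circle_uniform)
  interpret W: prob_space "GUE n" by (rule prob_space_GUE)
  interpret XW: pair_prob_space "\<Pi>\<^sub>M i\<in>{..<n}. circle_uniform" "GUE n" ..
  show ?thesis
    unfolding GSynch_U1_def
    by (intro XW.prob_space_distr measurable_synch_matrix)
qed

end

theory Submission imports Defs begin

text \<open>Second moment method. Conditionally on \<open>x\<close>, the spike shifts the Gaussian entries, so it
  contributes an explicit exponential likelihood ratio \<open>R x\<close>, and the likelihood ratio of the two
  models is \<open>L = E\<^sub>x (R x)\<close>. Cauchy--Schwarz gives \<open>P(A)\<^sup>2 \<le> Q(A) * E L\<^sup>2\<close>, so it suffices to bound
  \<open>E L\<^sup>2\<close> uniformly in \<open>n\<close>. Integrating out the Gaussian noise,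
  \<open>E L\<^sup>2 = E exp (l\<^sup>2 / n * \<bar>\<Sum>i<n. x\<^sub>i cnj y\<^sub>i\<bar>\<^sup>2)\<close> for independent \<open>x\<close> and \<open>y\<close>. By
  Parseval, \<open>E \<bar>\<Sum>i<n. x\<^sub>i c\<^sub>i\<bar> ^ (2 * k) \<le> k! n ^ k\<close> for unimodular \<open>c\<close>, and summing the
  exponential series yields the bound \<open>\<Sum>k. l ^ (2 * k) = 1 / (1 - l\<^sup>2)\<close>.\<close>

section \<open>Exponential moments of sums of phases\<close>

text \<open>Orthogonality of characters: for \<open>m\<close> nonzero the antiderivative
  \<open>cis (m * t) / (i * m)\<close> takes equal values at 0 and 2 pi.\<close>

lemma has_integral_cis_int:
  "((\<lambda>t. cis (of_int m * t)) has_integral (if m = 0 then 2 * pi else 0)) {0..2 * pi}"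
proof (cases "m = 0")
  case True
  then show ?thesis
    using has_integral_const_real[of "1 :: complex" 0 "2 * pi"] by (simp add: scaleR_conv_of_real)
next
  case False
  define F where "F t = cis (of_int m * t) / (\<i> * of_int m)" for t
  have "((\<lambda>t. cis (of_int m * t)) has_integral F (2 * pi) - F 0) {0..2 * pi}"
  proof (rule fundamental_theorem_of_calculus)
    fix t :: real
    have "((\<lambda>t. exp (\<i> * of_real (of_int m * t)) / (\<i> * of_int m)) has_vector_derivative
        exp (\<i> * of_real (of_int m * t))) (at t within {0..2 * pi})"
      using False
      by (auto intro!: derivative_eq_intros has_vector_derivative_real_field
          simp: field_simps)
    then show "(F has_vector_derivative cis (of_int m * t)) (at t within {0..2 * pi})"
      by (simp add: F_def[abs_def] cis_conv_exp)
  qed simp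
  moreover have "cis (of_int m * (2 * pi)) = 1"
    using cis_multiple_2pi[of "of_int m"] by (simp add: mult.commute)
  ultimately show ?thesis using False by (simp add: F_def)
qed

text \<open>Transfers a gauge integral over angles to the circle law; dividing by the length 2 pi
  comes from normalizing the uniform measure.\<close>

lemma nn_integral_circle_uniform:
  assumes [measurable]: "f \<in> borel_measurable borel"
  assumes f: "\<And>z. 0 \<le> f z"
  assumes I: "((\<lambda>t. f (cis t)) has_integral I) {0..2 * pi}"
  shows "(\<integral>\<^sup>+z. ennreal (f z) \<partial>circle_uniform) = ennreal (I / (2 * pi))"
proof -
  note measurable_cis[measurable]
  have "(\<integral>\<^sup>+t. ennreal (indicator {0..2 * pi} t * f (cis t)) \<partial>lborel) = ennreal I"
    by (rule nn_integral_has_integral_lborel)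
       (use I has_integral_restrict_UNIV[of "{0..2 * pi}" "\<lambda>t. f (cis t)" I] f
         in \<open>auto simp: indicator_def of_bool_def if_distrib[of "\<lambda>x. x * _"] cong: if_cong\<close>)
  then have "(\<integral>\<^sup>+t. ennreal (f (cis t)) * indicator {0..2 * pi} t \<partial>lborel) = ennreal I"
    by (simp add: nn_integral_set_ennreal mult.commute f)
  moreover have "0 \<le> I" using has_integral_nonneg[OF I] f by simp
  ultimately show ?thesis
    by (simp add: circle_uniform_def nn_integral_distr nn_integral_uniform_measure
        divide_ennreal)
qed

text \<open>Parseval's identity: the squared modulus expands into a double sum of characters of
  frequency \<open>j - l\<close>, and only the diagonal survives integration.\<close>

lemma nn_integral_circle_uniform_polynomial:
  "(\<integral>\<^sup>+z. ennreal ((norm (\<Sum>j\<le>k. a j * z ^ j))\<^sup>2) \<partial>circle_uniform)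
     = ennreal (\<Sum>j\<le>k. (norm (a j))\<^sup>2)"
proof -
  have expand: "complex_of_real ((norm (\<Sum>j\<le>k. a j * cis t ^ j))\<^sup>2)
      = (\<Sum>j\<le>k. \<Sum>l\<le>k. (a j * cnj (a l)) * cis (of_int (int j - int l) * t))" for t
  proof -
    have "(a j * cis t ^ j) * cnj (a l * cis t ^ l)
        = (a j * cnj (a l)) * cis (of_int (int j - int l) * t)" for j l
    proof -
      have "cis t ^ j * cnj (cis t ^ l) = cis (of_int (int j - int l) * t)"
        unfolding Complex.DeMoivre cis_cnj cis_mult by (simp add: left_diff_distrib)
      then show ?thesis by (simp add: mult_ac)
    qed
    then show ?thesis
      unfolding complex_norm_square cnj_sum sum_product by (simp only:)
  qed
  have "((\<lambda>t. \<Sum>j\<le>k. \<Sum>l\<le>k. (a j * cnj (a l)) * cis (of_int (int j - int l) * t))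
      has_integral (\<Sum>j\<le>k. \<Sum>l\<le>k. (a j * cnj (a l)) *
        (if int j - int l = 0 then 2 * pi else 0))) {0..2 * pi}"
    by (intro has_integral_sum has_integral_mult_right has_integral_cis_int) auto
  also have "(\<Sum>j\<le>k. \<Sum>l\<le>k. (a j * cnj (a l)) * (if int j - int l = 0 then 2 * pi else 0))
      = complex_of_real (2 * pi * (\<Sum>j\<le>k. (norm (a j))\<^sup>2))"
    by (simp add: if_distrib[of complex_of_real] if_distrib[of "\<lambda>x. _ * x"] sum.delta
        sum_distrib_left mult.commute flip: complex_norm_square cong: if_cong)
  finally have "((\<lambda>t. complex_of_real ((norm (\<Sum>j\<le>k. a j * cis t ^ j))\<^sup>2)) has_integral
      complex_of_real (2 * pi * (\<Sum>j\<le>k. (norm (a j))\<^sup>2))) {0..2 * pi}"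
    unfolding expand .
  from has_integral_Re[OF this] have
    "((\<lambda>t. (norm (\<Sum>j\<le>k. a j * cis t ^ j))\<^sup>2) has_integral
      2 * pi * (\<Sum>j\<le>k. (norm (a j))\<^sup>2)) {0..2 * pi}"
    unfolding Re_complex_of_real .
  then show ?thesis
    by (subst nn_integral_circle_uniform) auto
qed

text \<open>\<open>(s + z * c) ^ k\<close> is a polynomial in \<open>z\<close> with binomial
  coefficients, so Parseval removes all cross terms, and \<open>norm c \<le> 1\<close> bounds the
  powers of \<open>c\<close>. The sum of \<open>ennreal\<close> terms can be integrated termwise in
  \<open>s\<close>.\<close>

lemma circle_uniform_moment_step:
  assumes "norm c \<le> 1"
  shows "(\<integral>\<^sup>+z. ennreal (norm (s + z * c) ^ (2 * k)) \<partial>circle_uniform)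
     \<le> (\<Sum>j\<le>k. ennreal ((real (k choose j))\<^sup>2) * ennreal (norm s ^ (2 * (k - j))))"
proof -
  define a where "a j = of_nat (k choose j) * c ^ j * s ^ (k - j)" for j
  have "norm (s + z * c) ^ (2 * k) = (norm (\<Sum>j\<le>k. a j * z ^ j))\<^sup>2" for z
  proof -
    have "(s + z * c) ^ k = (\<Sum>j\<le>k. a j * z ^ j)"
      using binomial_ring[of "z * c" s k]
      by (simp add: a_def power_mult_distrib add.commute algebra_simps)
    then have "(norm (\<Sum>j\<le>k. a j * z ^ j))\<^sup>2 = (norm (s + z * c) ^ k)\<^sup>2"
      by (simp add: norm_power[symmetric])
    then show ?thesis
      by (simp add: power_mult[symmetric] mult.commute)
  qed
  then have "(\<integral>\<^sup>+z. ennreal (norm (s + z * c) ^ (2 * k)) \<partial>circle_uniform)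
      = ennreal (\<Sum>j\<le>k. (norm (a j))\<^sup>2)"
    by (simp add: nn_integral_circle_uniform_polynomial)
  also have "\<dots> \<le> ennreal (\<Sum>j\<le>k. (real (k choose j))\<^sup>2 * norm s ^ (2 * (k - j)))"
  proof (intro ennreal_leI sum_mono)
    fix j
    have "(norm (a j))\<^sup>2 = (real (k choose j))\<^sup>2 * norm s ^ (2 * (k - j)) * norm c ^ (2 * j)"
      by (simp add: a_def norm_mult norm_power power_mult_distrib power_mult[symmetric]
          mult.commute)
    also have "\<dots> \<le> (real (k choose j))\<^sup>2 * norm s ^ (2 * (k - j)) * 1"
      using assms by (intro mult_left_mono power_le_one) auto
    finally show "(norm (a j))\<^sup>2 \<le> (real (k choose j))\<^sup>2 * norm s ^ (2 * (k - j))" by simp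
  qed
  also have "\<dots> = (\<Sum>j\<le>k. ennreal ((real (k choose j))\<^sup>2) * ennreal (norm s ^ (2 * (k - j))))"
    by (simp add: sum_ennreal[symmetric] ennreal_mult)
  finally show ?thesis .
qed

abbreviation circle_product :: "nat \<Rightarrow> (nat \<Rightarrow> complex) measure" where
  "circle_product n \<equiv> \<Pi>\<^sub>M i\<in>{..<n}. circle_uniform"

lemma borel_measurable_circle_product_component:
  "f \<in> N \<rightarrow>\<^sub>M circle_product n \<Longrightarrow> i < n \<Longrightarrow> (\<lambda>z. f z i) \<in> borel_measurable N"
  using measurable_compose[OF _ measurable_component_singleton[of i "{..<n}"]]
    measurable_cong_sets[OF refl sets_circle_uniform] by blast

text \<open>The bound is the moment of order \<open>2 * k\<close> of a complex Gaussian with second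
  absolute moment \<open>n\<close>. Induction peels off the last phase; \<open>k\<close> stays
  arbitrary because the step calls on all lower moments.\<close>

lemma circle_product_moment:
  assumes "\<And>i. norm (c i) \<le> 1"
  shows "(\<integral>\<^sup>+x. ennreal (norm (\<Sum>i<n. x i * c i) ^ (2 * k)) \<partial>circle_product n)
     \<le> ennreal (fact k * real n ^ k)"
proof (induction n arbitrary: k)
  case 0
  interpret product_sigma_finite "\<lambda>_ :: nat. circle_uniform"
    by (simp add: product_sigma_finite_def prob_space_circle_uniform prob_space_imp_sigma_finite)
  have "(\<integral>\<^sup>+x. ennreal (norm (\<Sum>i<0. x i * c i) ^ (2 * k))
      \<partial>(\<Pi>\<^sub>M i\<in>{}. circle_uniform)) = ennreal (0 ^ (2 * k))"
    by (subst nn_integral_empty) simp_all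
  \<comment> \<open>For \<open>k = 0\<close> both sides are 1 by the convention
    \<open>0 ^ 0 = 1\<close>; for larger \<open>k\<close> both vanish.\<close>
  then show ?case by (cases k) (simp_all del: nn_integral_const)
next
  case (Suc n)
  interpret P: product_sigma_finite "\<lambda>_ :: nat. circle_uniform"
    by (simp add: product_sigma_finite_def prob_space_circle_uniform prob_space_imp_sigma_finite)
  let ?X = "circle_product n"
  note comp = borel_measurable_circle_product_component[OF measurable_ident_sets[OF refl]]
  have meas: "(\<lambda>x. ennreal (norm (\<Sum>i<m. x i * c i) ^ q))
      \<in> borel_measurable (circle_product m)" for m q
    by (intro borel_measurable_sum measurable_compose[OF _ measurable_ennreal]
        borel_measurable_power borel_measurable_norm borel_measurable_times comp) auto
  have "(\<integral>\<^sup>+x. ennreal (norm (\<Sum>i<Suc n. x i * c i) ^ (2 * k))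
        \<partial>circle_product (Suc n))
    = (\<integral>\<^sup>+x. \<integral>\<^sup>+z. ennreal (norm ((\<Sum>i<n. x i * c i) + z * c n) ^ (2 * k))
        \<partial>circle_uniform \<partial>?X)"
    using meas[of "Suc n" "2 * k"]
    by (simp add: lessThan_Suc P.product_nn_integral_insert add.commute)
  also have "\<dots> \<le> (\<integral>\<^sup>+x. (\<Sum>j\<le>k. ennreal ((real (k choose j))\<^sup>2)
      * ennreal (norm (\<Sum>i<n. x i * c i) ^ (2 * (k - j)))) \<partial>?X)"
    by (intro nn_integral_mono circle_uniform_moment_step assms)
  also have "\<dots> = (\<Sum>j\<le>k. ennreal ((real (k choose j))\<^sup>2)
      * (\<integral>\<^sup>+x. ennreal (norm (\<Sum>i<n. x i * c i) ^ (2 * (k - j))) \<partial>?X))"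
    by (subst nn_integral_sum)
       (auto intro!: borel_measurable_times meas sum.cong nn_integral_cmult)
  also have "\<dots> \<le> (\<Sum>j\<le>k. ennreal ((real (k choose j))\<^sup>2)
      * ennreal (fact (k - j) * real n ^ (k - j)))"
    by (intro sum_mono mult_left_mono Suc.IH) auto
  also have "\<dots> = ennreal (\<Sum>j\<le>k. (real (k choose j))\<^sup>2 * (fact (k - j) * real n ^ (k - j)))"
    by (simp add: sum_ennreal[symmetric] ennreal_mult)
  \<comment> \<open>One binomial coefficient is spent on
    \<open>(k choose j) * fact (k - j) = fact k / fact j \<le> fact k\<close>; the other feeds the
    binomial theorem for \<open>(1 + n) ^ k\<close>.\<close>
  also have "\<dots> \<le> ennreal (\<Sum>j\<le>k. fact k * (real (k choose j) * real n ^ (k - j)))"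
  proof (intro ennreal_leI sum_mono)
    fix j assume "j \<in> {..k}"
    then have "real (fact j * fact (k - j) * (k choose j)) = fact k"
      by (subst binomial_fact_lemma) auto
    moreover have "real (k choose j) * fact (k - j) * 1
        \<le> real (k choose j) * fact (k - j) * fact j"
      by (intro mult_left_mono) (auto simp: fact_ge_1)
    ultimately have "real (k choose j) * fact (k - j) \<le> fact k"
      by (simp add: mult_ac)
    then have "(real (k choose j) * fact (k - j)) * (real (k choose j) * real n ^ (k - j))
       \<le> fact k * (real (k choose j) * real n ^ (k - j))"
      by (rule mult_right_mono) auto
    then show "(real (k choose j))\<^sup>2 * (fact (k - j) * real n ^ (k - j))
       \<le> fact k * (real (k choose j) * real n ^ (k - j))"
      by (simp add: power2_eq_square mult_ac)
  qed
  also have "(\<Sum>j\<le>k. fact k * (real (k choose j) * real n ^ (k - j))) = fact k * real (Suc n) ^ k"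
    using binomial_ring[of 1 "real n" k] by (simp add: sum_distrib_left)
  finally show ?case .
qed

text \<open>In the exponential series the moment bound cancels \<open>fact k\<close>, leaving a
  geometric series in \<open>t * n\<close>. Bounding \<open>t * n\<close> by \<open>q\<close> also
  covers \<open>n = 0\<close>, where \<open>t = l^2 / n\<close> is 0.\<close>

lemma circle_product_exp_moment:
  assumes "\<And>i. norm (c i) \<le> 1" and "0 \<le> t" and "t * real n \<le> q" and "q < 1"
  shows "(\<integral>\<^sup>+x. ennreal (exp (t * (norm (\<Sum>i<n. x i * c i))\<^sup>2))
      \<partial>circle_product n) \<le> ennreal (1 / (1 - q))"
proof -
  let ?X = "circle_product n"
  let ?S = "\<lambda>x. norm (\<Sum>i<n. x i * c i)"
  have q: "0 \<le> q" using assms(2,3) by (meson mult_nonneg_nonneg of_nat_0_le_iff order_trans)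
  note comp = borel_measurable_circle_product_component[OF measurable_ident_sets[OF refl]]
  have meas: "(\<lambda>x. ennreal (?S x ^ k)) \<in> borel_measurable ?X" for k
    by (intro borel_measurable_sum measurable_compose[OF _ measurable_ennreal]
        borel_measurable_power borel_measurable_norm borel_measurable_times comp) auto
  have "ennreal (exp (t * (?S x)\<^sup>2)) = (\<Sum>k. ennreal (t ^ k / fact k) * ennreal (?S x ^ (2 * k)))"
    for x
  proof -
    have "(\<lambda>k. (t * (?S x)\<^sup>2) ^ k /\<^sub>R fact k) sums exp (t * (?S x)\<^sup>2)" by (rule exp_converges)
    then have "(\<lambda>k. t ^ k / fact k * ?S x ^ (2 * k)) sums exp (t * (?S x)\<^sup>2)"
      by (simp add: power_mult_distrib power_mult[symmetric] field_simps)
    then have "(\<Sum>k. ennreal (t ^ k / fact k * ?S x ^ (2 * k))) = ennreal (exp (t * (?S x)\<^sup>2))"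
      by (intro suminf_ennreal_eq) (use assms(2) in auto)
    then show ?thesis using assms(2) by (simp add: ennreal_mult del: times_divide_eq_left)
  qed
  then have "(\<integral>\<^sup>+x. ennreal (exp (t * (?S x)\<^sup>2)) \<partial>?X)
      = (\<Sum>k. ennreal (t ^ k / fact k) * (\<integral>\<^sup>+x. ennreal (?S x ^ (2 * k)) \<partial>?X))"
    by (simp add: nn_integral_suminf nn_integral_cmult meas)
  also have "\<dots> \<le> (\<Sum>k. ennreal (q ^ k))"
  proof (rule suminf_le)
    fix k
    have "ennreal (t ^ k / fact k) * (\<integral>\<^sup>+x. ennreal (?S x ^ (2 * k)) \<partial>?X)
        \<le> ennreal (t ^ k / fact k) * ennreal (fact k * real n ^ k)"
      by (intro mult_left_mono circle_product_moment assms) auto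
    also have "\<dots> = ennreal ((t * real n) ^ k)"
      using assms(2) by (simp add: ennreal_mult[symmetric] power_mult_distrib)
    also have "\<dots> \<le> ennreal (q ^ k)"
      using assms(2,3) by (intro ennreal_leI power_mono) auto
    finally show "ennreal (t ^ k / fact k) * (\<integral>\<^sup>+x. ennreal (?S x ^ (2 * k)) \<partial>?X)
        \<le> ennreal (q ^ k)" .
  qed auto
  also have "\<dots> = ennreal (1 / (1 - q))"
    using geometric_sums[of q] q assms(4) by (intro suminf_ennreal_eq) auto
  finally show ?thesis .
qed

section \<open>Gaussian shifts\<close>

text \<open>One-dimensional Cameron-Martin formula: translation invariance of Lebesgue measure moves
  the shift onto the density, and the exponential is the ratio of the two densities.\<close>

lemma nn_integral_normal_law_shift:
  assumes "0 < v" and [measurable]: "f \<in> borel_measurable borel"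
  shows "(\<integral>\<^sup>+x. f (x + a) \<partial>normal_law v)
     = (\<integral>\<^sup>+x. f x * ennreal (exp ((a * x - a\<^sup>2 / 2) / v)) \<partial>normal_law v)"
proof -
  have dens: "normal_density 0 (sqrt v) (x - a)
      = exp ((a * x - a\<^sup>2 / 2) / v) * normal_density 0 (sqrt v) x" for x
    using assms(1)
    by (simp add: normal_density_def exp_add[symmetric] mult.left_commute)
       (simp add: field_simps power2_eq_square)
  have "(\<integral>\<^sup>+x. f (x + a) \<partial>normal_law v)
      = (\<integral>\<^sup>+x. ennreal (normal_density 0 (sqrt v) x) * f (a + x) \<partial>lborel)"
    by (simp add: normal_law_def nn_integral_density add.commute)
  also have "\<dots> = (\<integral>\<^sup>+x. ennreal (normal_density 0 (sqrt v) (x - a)) * f x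
      \<partial>distr lborel borel ((+) a))"
    by (simp add: nn_integral_distr)
  also have "\<dots> = (\<integral>\<^sup>+x. ennreal (normal_density 0 (sqrt v) (x - a)) * f x \<partial>lborel)"
    by (simp add: lborel_distr_plus)
  also have "\<dots> = (\<integral>\<^sup>+x. f x * ennreal (exp ((a * x - a\<^sup>2 / 2) / v)) \<partial>normal_law v)"
    by (simp add: normal_law_def nn_integral_density dens ennreal_mult mult_ac)
  finally show ?thesis .
qed

text \<open>The real inner product on \<^typ>\<open>complex\<close> treats both kinds of entries at once: the density of
  an entry is proportional to \<open>exp (- gue_precision p * (norm w)\<^sup>2 / 2)\<close>, on the real line for
  diagonal \<open>p\<close>.\<close>

definition gue_precision :: "nat \<times> nat \<Rightarrow> real" where
  "gue_precision p = (if fst p = snd p then 1 else 2)"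

text \<open>Density of the entry law translated by \<open>m\<close> relative to the original: the
  exponent is half the precision times \<open>norm w ^ 2 - norm (w - m) ^ 2\<close>.\<close>

definition entry_likelihood :: "nat \<times> nat \<Rightarrow> complex \<Rightarrow> complex \<Rightarrow> real" where
  "entry_likelihood p m w = exp (gue_precision p * (m \<bullet> w - (norm m)\<^sup>2 / 2))"

lemma borel_measurable_entry_likelihood [measurable (raw)]:
  assumes [measurable]: "f \<in> borel_measurable M" "g \<in> borel_measurable M"
  shows "(\<lambda>x. entry_likelihood p (f x) (g x)) \<in> borel_measurable M"
  unfolding entry_likelihood_def by measurable

text \<open>A diagonal entry lives on the real line, so its shift must be real to keep the laws
  mutually absolutely continuous. Off the diagonal the one-dimensional formula applies to the
  imaginary and then the real part.\<close>

lemma nn_integral_gue_entry_shift: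
  assumes diag: "fst p = snd p \<Longrightarrow> Im m = 0"
    and f [measurable]: "f \<in> borel_measurable borel"
  shows "(\<integral>\<^sup>+w. f (w + m) \<partial>gue_entry p)
     = (\<integral>\<^sup>+w. f w * ennreal (entry_likelihood p m w) \<partial>gue_entry p)"
proof (cases "fst p = snd p")
  case True
  then have m: "m = complex_of_real (Re m)" using diag by (simp add: complex_eq_iff)
  have gue: "gue_entry p = distr (normal_law 1) borel complex_of_real"
    using True by (simp add: gue_entry_def case_prod_beta')
  have "(\<integral>\<^sup>+w. f (w + m) \<partial>gue_entry p)
      = (\<integral>\<^sup>+x. f (complex_of_real (x + Re m)) \<partial>normal_law 1)"
    unfolding gue by (subst m) (simp add: nn_integral_distr)
  also have "\<dots> = (\<integral>\<^sup>+x. f (complex_of_real x)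
      * ennreal (exp ((Re m * x - (Re m)\<^sup>2 / 2) / 1)) \<partial>normal_law 1)"
    by (rule nn_integral_normal_law_shift[of 1 "\<lambda>x. f (complex_of_real x)"]) auto
  also have "\<dots> = (\<integral>\<^sup>+w. f w * ennreal (entry_likelihood p m w) \<partial>gue_entry p)"
    unfolding gue using True diag
    by (simp add: nn_integral_distr entry_likelihood_def gue_precision_def inner_complex_def
        cmod_power2)
  finally show ?thesis .
next
  case False
  let ?N = "normal_law (1/2)"
  let ?r = "\<lambda>a x. ennreal (exp ((a * x - a\<^sup>2 / 2) / (1 / 2)))"
  have gue: "gue_entry p = distr (?N \<Otimes>\<^sub>M ?N) borel (\<lambda>(a, b). Complex a b)"
    using False by (simp add: gue_entry_def case_prod_beta')
  interpret N: prob_space ?N by (rule prob_space_normal_law) simp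
  have sNN: "sets (?N \<Otimes>\<^sub>M ?N) = sets (borel \<Otimes>\<^sub>M borel)"
    by (intro sets_pair_measure_cong) simp_all
  have C: "(\<lambda>(a, b). Complex a b) \<in> borel_measurable (?N \<Otimes>\<^sub>M ?N)"
    using measurable_Complex measurable_cong_sets[OF sNN refl] by blast
  have C1 [measurable]: "(\<lambda>y. Complex (g y) (h y)) \<in> borel_measurable M"
    if [measurable]: "g \<in> borel_measurable M" "h \<in> borel_measurable M"
    for M :: "'a measure" and g h
    using measurable_compose[OF measurable_Pair[OF that] measurable_Complex] by simp
  have int: "(\<integral>\<^sup>+w. g w \<partial>gue_entry p) = (\<integral>\<^sup>+x. \<integral>\<^sup>+y. g (Complex x y) \<partial>?N \<partial>?N)"
    if [measurable]: "g \<in> borel_measurable borel" for g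
    unfolding gue using C
    by (simp add: nn_integral_distr N.nn_integral_fst[symmetric] case_prod_beta')
  have plus: "Complex x y + m = Complex (x + Re m) (y + Im m)" for x y
    by (simp add: complex_eq_iff)
  have shift: "(\<integral>\<^sup>+x. g (x + a) \<partial>?N) = (\<integral>\<^sup>+x. g x * ?r a x \<partial>?N)"
    if "g \<in> borel_measurable borel" for g a
    by (rule nn_integral_normal_law_shift) (use that in auto)
  have "(\<integral>\<^sup>+w. f (w + m) \<partial>gue_entry p)
      = (\<integral>\<^sup>+x. \<integral>\<^sup>+y. f (Complex (x + Re m) (y + Im m)) \<partial>?N \<partial>?N)"
    by (simp add: int plus)
  also have "\<dots> = (\<integral>\<^sup>+x. \<integral>\<^sup>+y. f (Complex (x + Re m) y) * ?r (Im m) y \<partial>?N \<partial>?N)"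
    by (intro nn_integral_cong shift) measurable
  also have "\<dots> = (\<integral>\<^sup>+x. (\<integral>\<^sup>+y. f (Complex x y) * ?r (Im m) y \<partial>?N) * ?r (Re m) x \<partial>?N)"
    by (rule shift) measurable
  also have "\<dots> = (\<integral>\<^sup>+x. \<integral>\<^sup>+y. f (Complex x y) * ennreal (entry_likelihood p m (Complex x y)) \<partial>?N \<partial>?N)"
  proof (intro nn_integral_cong)
    fix x
    \<comment> \<open>Dividing by the variance 1/2 gives precision 2, and the two coordinate
      exponents add up to the real inner product.\<close>
    have "?r (Im m) y * ?r (Re m) x = ennreal (entry_likelihood p m (Complex x y))" for y
      using False
      by (simp add: ennreal_mult[symmetric] exp_add[symmetric] entry_likelihood_def
          gue_precision_def inner_complex_def cmod_power2 algebra_simps)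
    then show "(\<integral>\<^sup>+y. f (Complex x y) * ?r (Im m) y \<partial>?N) * ?r (Re m) x
        = (\<integral>\<^sup>+y. f (Complex x y) * ennreal (entry_likelihood p m (Complex x y)) \<partial>?N)"
      by (subst nn_integral_multc[symmetric]) (auto simp: mult.assoc)
  qed
  also have "\<dots> = (\<integral>\<^sup>+w. f w * ennreal (entry_likelihood p m w) \<partial>gue_entry p)"
    by (simp add: int)
  finally show ?thesis .
qed

text \<open>Reading the second likelihood as a shift by \<open>m'\<close> multiplies the first by
  the constant \<open>exp (gue_precision p * (m \<bullet> m'))\<close>; the remaining likelihood has
  total mass 1.\<close>

lemma nn_integral_entry_likelihood_mult:
  assumes "fst p = snd p \<Longrightarrow> Im m = 0" and "fst p = snd p \<Longrightarrow> Im m' = 0"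
  shows "(\<integral>\<^sup>+w. ennreal (entry_likelihood p m w) * ennreal (entry_likelihood p m' w) \<partial>gue_entry p)
     = ennreal (exp (gue_precision p * (m \<bullet> m')))"
proof -
  interpret prob_space "gue_entry p" by (rule prob_space_gue_entry)
  have total: "(\<integral>\<^sup>+w. ennreal (entry_likelihood p m w) \<partial>gue_entry p) = 1"
    using nn_integral_gue_entry_shift[of p m "\<lambda>_. 1"] assms(1) by (simp add: emeasure_space_1)
  have "(\<integral>\<^sup>+w. ennreal (entry_likelihood p m w) * ennreal (entry_likelihood p m' w) \<partial>gue_entry p)
      = (\<integral>\<^sup>+w. ennreal (entry_likelihood p m (w + m')) \<partial>gue_entry p)"
    using assms(2) by (intro nn_integral_gue_entry_shift[symmetric]) auto
  also have "\<dots> = (\<integral>\<^sup>+w. ennreal (exp (gue_precision p * (m \<bullet> m')))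
      * ennreal (entry_likelihood p m w) \<partial>gue_entry p)"
    by (intro nn_integral_cong)
       (simp add: entry_likelihood_def inner_add_right exp_add[symmetric] ennreal_mult[symmetric]
         algebra_simps)
  also have "\<dots> = ennreal (exp (gue_precision p * (m \<bullet> m')))"
    by (simp add: nn_integral_cmult total)
  finally show ?thesis .
qed

section \<open>Coordinatewise transformations of product measures\<close>

text \<open>Both sides are the product of the transformed factor laws, which is determined by its
  values on boxes.\<close>

lemma distr_PiM_eq_density:
  fixes M :: "'i \<Rightarrow> 'a measure"
  assumes fin: "finite I" and M: "\<And>i. prob_space (M i)"
    and T: "\<And>i. i \<in> I \<Longrightarrow> T i \<in> M i \<rightarrow>\<^sub>M M i"
    and r: "\<And>i. i \<in> I \<Longrightarrow> r i \<in> borel_measurable (M i)"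
    and eq: "\<And>i. i \<in> I \<Longrightarrow> distr (M i) (M i) (T i) = density (M i) (r i)"
  shows "distr (PiM I M) (PiM I M) (\<lambda>w. \<lambda>i\<in>I. T i (w i))
     = density (PiM I M) (\<lambda>w. \<Prod>i\<in>I. r i (w i))"
proof -
  \<comment> \<open>Outside \<open>I\<close> the factor falls back to \<open>M i\<close>, so that
    every \<open>D i\<close> is a probability measure although \<open>T\<close> is controlled only
    on \<open>I\<close>.\<close>
  define D where "D i = (if i \<in> I then distr (M i) (M i) (T i) else M i)" for i
  interpret M: product_prob_space M I
    by (simp add: product_prob_space_def product_sigma_finite_def product_prob_space_axioms_def
        M prob_space_imp_sigma_finite)
  have D: "prob_space (D i)" for i
    using M T by (auto simp: D_def intro!: prob_space.prob_space_distr)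
  interpret D: product_prob_space D I
    by (simp add: product_prob_space_def product_sigma_finite_def product_prob_space_axioms_def
        D prob_space_imp_sigma_finite)
  have sD: "sets (D i) = sets (M i)" for i by (simp add: D_def)
  have sPi: "sets (PiM I D) = sets (PiM I M)" by (intro sets_PiM_cong) (auto simp: sD)
  have Tm: "(\<lambda>w. \<lambda>i\<in>I. T i (w i)) \<in> PiM I M \<rightarrow>\<^sub>M PiM I M"
    using T by (intro measurable_restrict measurable_compose[OF measurable_component_singleton]) auto
  have rm: "(\<lambda>w. \<Prod>i\<in>I. r i (w i)) \<in> borel_measurable (PiM I M)"
    proof (rule borel_measurable_prod_ennreal)
    fix i assume i: "i \<in> I"
    show "(\<lambda>w. r i (w i)) \<in> borel_measurable (PiM I M)"
      by (rule measurable_compose[OF measurable_component_singleton[OF i, of M] r[OF i]])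
  qed
  have "distr (PiM I M) (PiM I M) (\<lambda>w. \<lambda>i\<in>I. T i (w i)) = PiM I D"
  proof (rule D.PiM_eqI[OF fin])
    fix A assume A: "\<And>i. i \<in> I \<Longrightarrow> A i \<in> sets (D i)"
    have A': "Pi\<^sub>E I A \<in> sets (PiM I M)"
      using A by (intro sets_PiM_I_finite fin) (auto simp: sD)
    have "(\<lambda>w. \<lambda>i\<in>I. T i (w i)) -` Pi\<^sub>E I A \<inter> space (PiM I M)
        = Pi\<^sub>E I (\<lambda>i. T i -` A i \<inter> space (M i))"
      by (auto simp: space_PiM PiE_iff)
    then have "emeasure (distr (PiM I M) (PiM I M) (\<lambda>w. \<lambda>i\<in>I. T i (w i))) (Pi\<^sub>E I A)
        = (\<Prod>i\<in>I. emeasure (M i) (T i -` A i \<inter> space (M i)))"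
      using A T by (subst emeasure_distr[OF Tm A']) (auto simp: sD M.emeasure_PiM fin)
    also have "\<dots> = (\<Prod>i\<in>I. emeasure (D i) (A i))"
      using A T by (intro prod.cong) (auto simp: D_def emeasure_distr)
    finally show "emeasure (distr (PiM I M) (PiM I M) (\<lambda>w. \<lambda>i\<in>I. T i (w i))) (Pi\<^sub>E I A)
        = (\<Prod>i\<in>I. emeasure (D i) (A i))" .
  qed (simp add: sPi)
  moreover have "density (PiM I M) (\<lambda>w. \<Prod>i\<in>I. r i (w i)) = PiM I D"
  proof (rule D.PiM_eqI[OF fin])
    fix A assume A: "\<And>i. i \<in> I \<Longrightarrow> A i \<in> sets (D i)"
    have A': "Pi\<^sub>E I A \<in> sets (PiM I M)"
      using A by (intro sets_PiM_I_finite fin) (auto simp: sD)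
    have "emeasure (density (PiM I M) (\<lambda>w. \<Prod>i\<in>I. r i (w i))) (Pi\<^sub>E I A)
        = (\<integral>\<^sup>+w. (\<Prod>i\<in>I. r i (w i)) * indicator (Pi\<^sub>E I A) w \<partial>PiM I M)"
      by (rule emeasure_density[OF rm A'])
    also have "\<dots> = (\<integral>\<^sup>+w. (\<Prod>i\<in>I. r i (w i) * indicator (A i) (w i)) \<partial>PiM I M)"
    proof (rule nn_integral_cong)
      fix w assume "w \<in> space (PiM I M)"
      then have "indicator (Pi\<^sub>E I A) w = (\<Prod>i\<in>I. indicator (A i) (w i) :: ennreal)"
        using fin by (auto simp: indicator_def space_PiM PiE_iff prod.If_cases)
      then show "(\<Prod>i\<in>I. r i (w i)) * indicator (Pi\<^sub>E I A) w
          = (\<Prod>i\<in>I. r i (w i) * indicator (A i) (w i))"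
        by (simp add: prod.distrib)
    qed
    also have "\<dots> = (\<Prod>i\<in>I. \<integral>\<^sup>+x. r i x * indicator (A i) x \<partial>M i)"
      using A r by (intro M.product_nn_integral_prod fin borel_measurable_times
          borel_measurable_indicator) (auto simp: sD)
    also have "\<dots> = (\<Prod>i\<in>I. emeasure (D i) (A i))"
      using A r by (intro prod.cong) (auto simp: D_def eq emeasure_density)
    finally show "emeasure (density (PiM I M) (\<lambda>w. \<Prod>i\<in>I. r i (w i))) (Pi\<^sub>E I A)
        = (\<Prod>i\<in>I. emeasure (D i) (A i))" .
  qed (simp add: sPi)
  ultimately show ?thesis by simp
qed

section \<open>The spiked model\<close>

abbreviation gue_upper :: "nat \<Rightarrow> cmatrix measure" where
  "gue_upper n \<equiv> \<Pi>\<^sub>M p\<in>upper_indices n. gue_entry p"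

text \<open>The signal before the overall scaling by \<open>1 / sqrt n\<close>, hence
  \<open>l / sqrt n\<close> in place of \<open>l / n\<close>.\<close>

definition spike :: "real \<Rightarrow> nat \<Rightarrow> (nat \<Rightarrow> complex) \<Rightarrow> cmatrix" where
  "spike l n x = (\<lambda>(i, j). of_real (l / sqrt (real n)) * (x i * cnj (x j)))"

text \<open>Only the upper triangle enters: its entries are independent and determine the Hermitian
  matrix.\<close>

definition likelihood :: "nat \<Rightarrow> cmatrix \<Rightarrow> cmatrix \<Rightarrow> ennreal" where
  "likelihood n m w = (\<Prod>p\<in>upper_indices n. ennreal (entry_likelihood p (m p) (w p)))"

lemma finite_upper_indices [simp]: "finite (upper_indices n)"
  by (rule finite_subset[of _ "{..<n} \<times> {..<n}"]) (auto simp: upper_indices_def)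

lemma Im_spike_diag: "fst p = snd p \<Longrightarrow> Im (spike l n x p) = 0"
  by (cases p) (simp add: spike_def complex_mult_cnj)

lemma borel_measurable_gue_upper_component:
  "f \<in> N \<rightarrow>\<^sub>M gue_upper n \<Longrightarrow> p \<in> upper_indices n \<Longrightarrow> (\<lambda>z. f z p) \<in> borel_measurable N"
  using measurable_compose[OF _ measurable_component_singleton[of p "upper_indices n" gue_entry]]
    measurable_cong_sets[OF refl sets_gue_entry] by blast

text \<open>Joint measurability in phases and noise, as required for exchanging the integrals over
  them.\<close>

lemma borel_measurable_likelihood_spike [measurable (raw)]:
  assumes f: "f \<in> N \<rightarrow>\<^sub>M circle_product n" and g: "g \<in> N \<rightarrow>\<^sub>M gue_upper n"
  shows "(\<lambda>z. likelihood n (spike l n (f z)) (g z)) \<in> borel_measurable N"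
  unfolding likelihood_def
proof (rule borel_measurable_prod_ennreal)
  fix p assume p: "p \<in> upper_indices n"
  obtain i j where ij: "p = (i, j)" "i < n" "j < n" using p by (auto simp: upper_indices_def)
  note [measurable] = borel_measurable_circle_product_component[OF f ij(2)]
    borel_measurable_circle_product_component[OF f ij(3)]
    borel_measurable_gue_upper_component[OF g p[unfolded ij(1)]]
  have cnj [measurable]: "(\<lambda>z. cnj (f z j)) \<in> borel_measurable N"
    by (rule measurable_compose[of "\<lambda>z. f z j" _ borel])
       (auto intro!: borel_measurable_continuous_onI continuous_intros)
  show "(\<lambda>z. ennreal (entry_likelihood p (spike l n (f z) p) (g z p))) \<in> borel_measurable N"
    unfolding ij(1) spike_def case_prod_conv by measurable
qed

text \<open>The entrywise shift formula, first read as an equality of measures on each entry, passes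
  to the product of the independent entries.\<close>

lemma nn_integral_gue_upper_shift:
  assumes diag: "\<And>p. fst p = snd p \<Longrightarrow> Im (m p) = 0"
    and f: "f \<in> borel_measurable (gue_upper n)"
  shows "(\<integral>\<^sup>+w. f (\<lambda>p\<in>upper_indices n. w p + m p) \<partial>gue_upper n)
     = (\<integral>\<^sup>+w. f w * likelihood n m w \<partial>gue_upper n)"
proof -
  have plus: "(\<lambda>w. w + m p) \<in> gue_entry p \<rightarrow>\<^sub>M gue_entry p" for p by measurable
  have eq: "distr (gue_entry p) (gue_entry p) (\<lambda>w. w + m p)
      = density (gue_entry p) (\<lambda>w. ennreal (entry_likelihood p (m p) w))" for p
  proof (rule measure_eqI)
    fix A assume A: "A \<in> sets (distr (gue_entry p) (gue_entry p) (\<lambda>w. w + m p))"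
    then have [measurable]: "A \<in> sets borel" by simp
    have "emeasure (distr (gue_entry p) (gue_entry p) (\<lambda>w. w + m p)) A
        = (\<integral>\<^sup>+w. indicator A w \<partial>distr (gue_entry p) (gue_entry p) (\<lambda>w. w + m p))"
      by simp
    also have "\<dots> = (\<integral>\<^sup>+w. indicator A (w + m p) \<partial>gue_entry p)"
      by (rule nn_integral_distr[OF plus]) simp
    also have "\<dots> = (\<integral>\<^sup>+w. indicator A w * ennreal (entry_likelihood p (m p) w) \<partial>gue_entry p)"
      by (rule nn_integral_gue_entry_shift) (auto simp: diag)
    finally show "emeasure (distr (gue_entry p) (gue_entry p) (\<lambda>w. w + m p)) A
        = emeasure (density (gue_entry p) (\<lambda>w. ennreal (entry_likelihood p (m p) w))) A"
      by (simp add: emeasure_density mult.commute)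
  qed simp
  have lik: "likelihood n m \<in> borel_measurable (gue_upper n)"
    unfolding likelihood_def
    by (intro borel_measurable_prod_ennreal measurable_compose[OF _ measurable_ennreal]
        borel_measurable_entry_likelihood borel_measurable_const
        borel_measurable_gue_upper_component measurable_ident_sets) simp_all
  have shift: "(\<lambda>w. \<lambda>p\<in>upper_indices n. w p + m p) \<in> gue_upper n \<rightarrow>\<^sub>M gue_upper n"
  proof (rule measurable_restrict)
    fix p assume p: "p \<in> upper_indices n"
    show "(\<lambda>w. w p + m p) \<in> gue_upper n \<rightarrow>\<^sub>M gue_entry p"
      by (rule measurable_compose[OF measurable_component_singleton[OF p, of gue_entry] plus])
  qed
  have "(\<integral>\<^sup>+w. f (\<lambda>p\<in>upper_indices n. w p + m p) \<partial>gue_upper n)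
      = (\<integral>\<^sup>+w. f w \<partial>distr (gue_upper n) (gue_upper n) (\<lambda>w. \<lambda>p\<in>upper_indices n. w p + m p))"
    using f by (simp add: nn_integral_distr[OF shift])
  also have "distr (gue_upper n) (gue_upper n) (\<lambda>w. \<lambda>p\<in>upper_indices n. w p + m p)
      = density (gue_upper n) (likelihood n m)"
    unfolding likelihood_def
    by (rule distr_PiM_eq_density) (use plus in \<open>auto simp: prob_space_gue_entry eq\<close>)
  also have "(\<integral>\<^sup>+w. f w \<partial>density (gue_upper n) (likelihood n m))
      = (\<integral>\<^sup>+w. f w * likelihood n m w \<partial>gue_upper n)"
    by (simp add: nn_integral_density lik f mult.commute)
  finally show ?thesis .
qed

text \<open>Precision 2 off the diagonal counts each strictly upper entry once more for its mirror
  image.\<close>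

lemma sum_upper_indices_symmetric:
  fixes h :: "nat \<Rightarrow> nat \<Rightarrow> real"
  assumes sym: "\<And>i j. h i j = h j i"
  shows "(\<Sum>p\<in>upper_indices n. gue_precision p * h (fst p) (snd p)) = (\<Sum>i<n. \<Sum>j<n. h i j)"
proof -
  let ?g = "\<lambda>p. h (fst p) (snd p)"
  let ?S = "{(i, j). i < j \<and> j < n}" and ?D = "(\<lambda>i. (i, i)) ` {..<n}"
    and ?L = "{(i, j). j < i \<and> i < n}"
  have fin: "finite ?S" "finite ?L"
    by (rule finite_subset[of _ "{..<n} \<times> {..<n}"]; force)+
  have U: "upper_indices n = ?S \<union> ?D"
    by (auto simp: upper_indices_def image_iff)
  have sq: "{..<n} \<times> {..<n} = (?S \<union> ?D) \<union> ?L" by force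
  have "(\<Sum>p\<in>upper_indices n. gue_precision p * ?g p) = 2 * sum ?g ?S + sum ?g ?D"
    unfolding U using fin
    by (subst sum.union_disjoint)
       (auto simp: gue_precision_def sum_distrib_left intro!: arg_cong2[where f="(+)"] sum.cong)
  also have "sum ?g ?S = sum ?g ?L"
    by (rule sum.reindex_bij_witness[of _ prod.swap prod.swap]) (auto simp: sym)
  then have "2 * sum ?g ?S + sum ?g ?D = sum ?g ({..<n} \<times> {..<n})"
    unfolding sq using fin
    by (subst sum.union_disjoint, simp, simp, force, subst sum.union_disjoint) auto
  also have "\<dots> = (\<Sum>i<n. \<Sum>j<n. h i j)"
    by (simp add: sum.cartesian_product case_prod_beta')
  finally show ?thesis .
qed

text \<open>With \<open>u i = x i * cnj (y i)\<close> the inner product of the rank-one entries is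
  \<open>u i \<bullet> u j\<close>, so the full double sum is the squared norm of the sum of the
  \<open>u i\<close>, the overlap of \<open>x\<close> and \<open>y\<close>.\<close>

lemma sum_gue_precision_spike_inner:
  "(\<Sum>p\<in>upper_indices n. gue_precision p * (spike l n x p \<bullet> spike l n y p))
     = l\<^sup>2 / real n * (norm (\<Sum>i<n. x i * cnj (y i)))\<^sup>2"
proof -
  define u where "u i = x i * cnj (y i)" for i
  have inner: "spike l n x p \<bullet> spike l n y p = l\<^sup>2 / real n * (u (fst p) \<bullet> u (snd p))" for p
  proof -
    obtain i j where p: "p = (i, j)" by (cases p)
    have "(l / sqrt (real n)) * (l / sqrt (real n)) = l\<^sup>2 / real n"
      by (simp add: power2_eq_square)
    moreover have "(x i * cnj (x j)) \<bullet> (y i * cnj (y j)) = u i \<bullet> u j"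
      by (simp add: u_def inner_complex_def algebra_simps)
    ultimately show ?thesis
      by (simp add: p spike_def scaleR_conv_of_real[symmetric] mult.assoc[symmetric]
          power2_eq_square del: of_real_divide)
  qed
  have "(\<Sum>p\<in>upper_indices n. gue_precision p * (spike l n x p \<bullet> spike l n y p))
      = (\<Sum>i<n. \<Sum>j<n. l\<^sup>2 / real n * (u i \<bullet> u j))"
    unfolding inner by (rule sum_upper_indices_symmetric) (simp add: inner_commute)
  also have "\<dots> = l\<^sup>2 / real n * (norm (\<Sum>i<n. u i))\<^sup>2"
    by (simp add: power2_norm_eq_inner inner_sum_left inner_sum_right sum_distrib_left
        inner_commute)
  finally show ?thesis by (simp add: u_def)
qed

text \<open>Independence of the entries factors the integral, and the exponents add up to the
  overlap.\<close>

lemma nn_integral_likelihood_spike_mult: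
  "(\<integral>\<^sup>+w. likelihood n (spike l n x) w * likelihood n (spike l n y) w \<partial>gue_upper n)
     = ennreal (exp (l\<^sup>2 / real n * (norm (\<Sum>i<n. x i * cnj (y i)))\<^sup>2))"
proof -
  interpret product_sigma_finite gue_entry
    by (simp add: product_sigma_finite_def prob_space_gue_entry prob_space_imp_sigma_finite)
  have "(\<integral>\<^sup>+w. likelihood n (spike l n x) w * likelihood n (spike l n y) w \<partial>gue_upper n)
      = (\<integral>\<^sup>+w. (\<Prod>p\<in>upper_indices n. ennreal (entry_likelihood p (spike l n x p) (w p))
          * ennreal (entry_likelihood p (spike l n y p) (w p))) \<partial>gue_upper n)"
    by (simp add: likelihood_def prod.distrib)
  also have "\<dots> = (\<Prod>p\<in>upper_indices n.
      ennreal (exp (gue_precision p * (spike l n x p \<bullet> spike l n y p))))"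
    by (subst product_nn_integral_prod)
       (auto intro!: prod.cong nn_integral_entry_likelihood_mult Im_spike_diag)
  also have "\<dots> = ennreal (exp (l\<^sup>2 / real n * (norm (\<Sum>i<n. x i * cnj (y i)))\<^sup>2))"
    by (simp add: prod_ennreal exp_sum[symmetric] sum_gue_precision_spike_inner)
  finally show ?thesis .
qed

section \<open>The law of the observed matrix\<close>

text \<open>The signal-free observation as a function of the upper-triangle noise; building it from
  \<open>synch_matrix\<close> lets measurability carry over.\<close>

definition noise_matrix :: "nat \<Rightarrow> cmatrix \<Rightarrow> cmatrix" where
  "noise_matrix n w = synch_matrix 0 n (\<lambda>_. 0) (hermitian_of_upper n w)"

text \<open>The spike is itself Hermitian, so adding its upper triangle before reflecting gives the
  same matrix. The signal thus becomes a translation of the Gaussian coordinates.\<close>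

lemma synch_matrix_hermitian_of_upper:
  "synch_matrix l n x (hermitian_of_upper n w)
     = noise_matrix n (\<lambda>p\<in>upper_indices n. w p + spike l n x p)"
proof (rule ext)
  fix p :: "nat \<times> nat"
  obtain i j where p: "p = (i, j)" by (cases p)
  have "complex_of_real (l / real n)
      = complex_of_real (1 / sqrt (real n)) * complex_of_real (l / sqrt (real n))"
    by (simp flip: of_real_mult)
  then show "synch_matrix l n x (hermitian_of_upper n w) p
      = noise_matrix n (\<lambda>p\<in>upper_indices n. w p + spike l n x p) p"
    by (auto simp: p synch_matrix_def noise_matrix_def hermitian_of_upper_def spike_def
        upper_indices_def algebra_simps simp del: of_real_divide)
qed

lemma measurable_noise_matrix: "noise_matrix n \<in> gue_upper n \<rightarrow>\<^sub>M matrix_space n"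
proof -
  \<comment> \<open>A point of the product space is \<open>undefined\<close> off the index set,
    hence the restricted zero vector; as the signal coefficient is 0, it gives the same matrix as
    the constant zero vector.\<close>
  have "(\<lambda>W. (\<lambda>i\<in>{..<n}. 0, W)) \<in> GUE n \<rightarrow>\<^sub>M circle_product n \<Otimes>\<^sub>M GUE n"
    by (intro measurable_Pair measurable_const measurable_ident_sets refl)
       (simp add: space_PiM circle_uniform_def)
  from measurable_compose[OF this measurable_synch_matrix[of 0 n]]
  have "(\<lambda>W. synch_matrix 0 n (\<lambda>i\<in>{..<n}. 0) W) \<in> matrix_space n \<rightarrow>\<^sub>M matrix_space n"
    by (simp add: measurable_cong_sets[OF sets_GUE refl])
  from measurable_compose[OF measurable_hermitian_of_upper this] show ?thesis
    by (simp add: noise_matrix_def[abs_def] synch_matrix_def)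
qed

text \<open>Condition on the phases, then trade the translation by the spike for its likelihood
  ratio. Only this ratio still depends on \<open>x\<close> and \<open>l\<close>.\<close>

lemma emeasure_GSynch_U1:
  assumes A: "A \<in> sets (matrix_space n)"
  shows "emeasure (GSynch_U1 l n) A
     = (\<integral>\<^sup>+x. \<integral>\<^sup>+w. indicator A (noise_matrix n w) * likelihood n (spike l n x) w
         \<partial>gue_upper n \<partial>circle_product n)"
proof -
  interpret W: prob_space "GUE n" by (rule prob_space_GUE)
  have ind: "(\<lambda>z. indicator A (case z of (x, W) \<Rightarrow> synch_matrix l n x W) :: ennreal)
      \<in> borel_measurable (circle_product n \<Otimes>\<^sub>M GUE n)"
    by (rule measurable_compose[OF measurable_synch_matrix borel_measurable_indicator[OF A]])
  have ind2: "(\<lambda>w. indicator A (noise_matrix n w) :: ennreal) \<in> borel_measurable (gue_upper n)"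
    by (rule measurable_compose[OF measurable_noise_matrix borel_measurable_indicator[OF A]])
  have "emeasure (GSynch_U1 l n) A = (\<integral>\<^sup>+Y. indicator A Y \<partial>GSynch_U1 l n)"
    using A by simp
  also have "\<dots> = (\<integral>\<^sup>+z. indicator A (case z of (x, W) \<Rightarrow> synch_matrix l n x W)
      \<partial>(circle_product n \<Otimes>\<^sub>M GUE n))"
    unfolding GSynch_U1_def using A
    by (intro nn_integral_distr[OF measurable_synch_matrix]) simp
  also have "\<dots> = (\<integral>\<^sup>+x. \<integral>\<^sup>+W. indicator A (synch_matrix l n x W) \<partial>GUE n \<partial>circle_product n)"
    using W.nn_integral_fst[OF ind] by simp
  also have "\<dots> = (\<integral>\<^sup>+x. \<integral>\<^sup>+w. indicator A (noise_matrix n w) * likelihood n (spike l n x) w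
         \<partial>gue_upper n \<partial>circle_product n)"
  proof (rule nn_integral_cong)
    fix x assume x: "x \<in> space (circle_product n)"
    have "(\<lambda>W. indicator A (synch_matrix l n x W) :: ennreal) \<in> borel_measurable (GUE n)"
      using measurable_compose[OF measurable_Pair1'[OF x] ind] by simp
    then have "(\<integral>\<^sup>+W. indicator A (synch_matrix l n x W) \<partial>GUE n)
        = (\<integral>\<^sup>+w. indicator A (synch_matrix l n x (hermitian_of_upper n w)) \<partial>gue_upper n)"
      unfolding GUE_def by (subst nn_integral_distr) (auto simp: measurable_hermitian_of_upper)
    also have "\<dots> = (\<integral>\<^sup>+w. indicator A (noise_matrix n w) * likelihood n (spike l n x) w
         \<partial>gue_upper n)"
      unfolding synch_matrix_hermitian_of_upper
      by (rule nn_integral_gue_upper_shift) (auto simp: Im_spike_diag ind2)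
    finally show "(\<integral>\<^sup>+W. indicator A (synch_matrix l n x W) \<partial>GUE n)
        = (\<integral>\<^sup>+w. indicator A (noise_matrix n w) * likelihood n (spike l n x) w \<partial>gue_upper n)" .
  qed
  finally show ?thesis .
qed

section \<open>Second moment bound and contiguity\<close>

text \<open>The underlying space of \<open>circle_uniform\<close> is all of the complex plane, so
  unimodularity holds only almost everywhere.\<close>

lemma AE_circle_product_norm: "AE x in circle_product n. \<forall>i<n. norm (x i) = 1"
proof -
  have "AE z in circle_uniform. norm z = 1"
    unfolding circle_uniform_def
    by (subst AE_distr_iff) (auto simp: measurable_cis measurable_cong_sets[OF sets_uniform_measure refl])
  then have "AE x in circle_product n. \<forall>i\<in>{..<n}. norm (x i) = 1"
    by (intro AE_finite_allI AE_PiM_component prob_space_circle_uniform) auto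
  then show ?thesis by (rule eventually_mono) auto
qed

text \<open>The square of the average over \<open>x\<close> is an average over two independent
  copies \<open>x\<close> and \<open>y\<close>. Integrating out the noise leaves an exponential of
  their overlap, bounded for almost every fixed \<open>y\<close> uniformly in
  \<open>n\<close>.\<close>

lemma likelihood_second_moment:
  assumes "0 \<le> l" and "l < 1"
  shows "(\<integral>\<^sup>+w. (\<integral>\<^sup>+x. likelihood n (spike l n x) w \<partial>circle_product n)\<^sup>2 \<partial>gue_upper n)
     \<le> ennreal (1 / (1 - l\<^sup>2))"
proof -
  let ?X = "circle_product n" and ?G = "gue_upper n" and ?R = "\<lambda>x w. likelihood n (spike l n x) w"
  interpret X: prob_space ?X by (intro prob_space_PiM prob_space_circle_uniform)
  interpret G: prob_space ?G by (intro prob_space_PiM prob_space_gue_entry)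
  interpret XG: pair_sigma_finite ?X ?G ..
  have "(\<integral>\<^sup>+w. (\<integral>\<^sup>+x. ?R x w \<partial>?X)\<^sup>2 \<partial>?G) = (\<integral>\<^sup>+w. \<integral>\<^sup>+y. \<integral>\<^sup>+x. ?R x w * ?R y w \<partial>?X \<partial>?X \<partial>?G)"
    by (intro nn_integral_cong) (simp add: power2_eq_square nn_integral_cmult nn_integral_multc)
  \<comment> \<open>Two exchanges bring the Gaussian integral innermost: first past
    \<open>y\<close>, then, for fixed \<open>y\<close>, past \<open>x\<close>.\<close>
  also have "\<dots> = (\<integral>\<^sup>+y. \<integral>\<^sup>+w. \<integral>\<^sup>+x. ?R x w * ?R y w \<partial>?X \<partial>?G \<partial>?X)"
    by (rule XG.Fubini') measurable
  also have "\<dots> = (\<integral>\<^sup>+y. \<integral>\<^sup>+x. \<integral>\<^sup>+w. ?R x w * ?R y w \<partial>?G \<partial>?X \<partial>?X)"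
    by (intro nn_integral_cong XG.Fubini') measurable
  also have "\<dots> = (\<integral>\<^sup>+y. \<integral>\<^sup>+x. ennreal (exp (l\<^sup>2 / real n * (norm (\<Sum>i<n. x i * cnj (y i)))\<^sup>2))
      \<partial>?X \<partial>?X)"
    by (simp only: nn_integral_likelihood_spike_mult)
  also have "\<dots> \<le> (\<integral>\<^sup>+y. ennreal (1 / (1 - l\<^sup>2)) \<partial>?X)"
  proof (rule nn_integral_mono_AE, rule AE_mp[OF AE_circle_product_norm[of n]], rule AE_I2, rule impI)
    fix y :: "nat \<Rightarrow> complex"
    assume y: "\<forall>i<n. norm (y i) = 1"
    \<comment> \<open>The moment bound wants coefficients of norm at most 1 at every index, while
      \<open>y\<close> is controlled only below \<open>n\<close>.\<close>
    let ?c = "\<lambda>i. if i < n then cnj (y i) else 0"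
    have "(\<integral>\<^sup>+x. ennreal (exp (l\<^sup>2 / real n * (norm (\<Sum>i<n. x i * ?c i))\<^sup>2)) \<partial>?X)
        \<le> ennreal (1 / (1 - l\<^sup>2))"
      using y assms by (intro circle_product_exp_moment) (auto simp: power_less_one_iff abs_square_less_1)
    then show "(\<integral>\<^sup>+x. ennreal (exp (l\<^sup>2 / real n * (norm (\<Sum>i<n. x i * cnj (y i)))\<^sup>2)) \<partial>?X)
        \<le> ennreal (1 / (1 - l\<^sup>2))"
      by simp
  qed
  also have "\<dots> = ennreal (1 / (1 - l\<^sup>2))"
    by (simp add: X.emeasure_space_1)
  finally show ?thesis .
qed

text \<open>Cauchy-Schwarz applied to the indicator of the event and the averaged likelihood, both
  as functions of the noise.\<close>

lemma GSynch_U1_second_moment_bound: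
  assumes l: "0 \<le> l" "l < 1" and A: "A \<in> sets (matrix_space n)"
  shows "(measure (GSynch_U1 l n) A)\<^sup>2 \<le> measure (GSynch_U1 0 n) A * (1 / (1 - l\<^sup>2))"
proof -
  let ?X = "circle_product n" and ?G = "gue_upper n" and ?R = "\<lambda>x w. likelihood n (spike l n x) w"
  let ?I = "\<lambda>w. indicator A (noise_matrix n w) :: ennreal"
  interpret X: prob_space ?X by (intro prob_space_PiM prob_space_circle_uniform)
  interpret G: prob_space ?G by (intro prob_space_PiM prob_space_gue_entry)
  interpret XG: pair_sigma_finite ?X ?G ..
  interpret P: prob_space "GSynch_U1 l n" by (rule prob_space_GSynch_U1)
  interpret Q: prob_space "GSynch_U1 0 n" by (rule prob_space_GSynch_U1)
  have I [measurable]: "?I \<in> borel_measurable ?G"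
    by (rule measurable_compose[OF measurable_noise_matrix borel_measurable_indicator[OF A]])
  have "likelihood n (spike 0 n x) w = 1" for x w
    by (simp add: likelihood_def entry_likelihood_def spike_def case_prod_beta')
  \<comment> \<open>At \<open>l = 0\<close> the likelihood is 1; since an indicator equals its
    square, the null probability already has the form Cauchy-Schwarz produces.\<close>
  then have Q: "emeasure (GSynch_U1 0 n) A = (\<integral>\<^sup>+w. ?I w ^ 2 \<partial>?G)"
    by (simp add: emeasure_GSynch_U1[OF A] X.emeasure_space_1 power2_eq_square
        indicator_inter_arith[symmetric])
  have "emeasure (GSynch_U1 l n) A = (\<integral>\<^sup>+w. \<integral>\<^sup>+x. ?I w * ?R x w \<partial>?X \<partial>?G)"
    unfolding emeasure_GSynch_U1[OF A] by (rule XG.Fubini'[symmetric]) measurable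
  also have "\<dots> = (\<integral>\<^sup>+w. ?I w * (\<integral>\<^sup>+x. ?R x w \<partial>?X) \<partial>?G)"
    by (intro nn_integral_cong nn_integral_cmult) measurable
  finally have "(emeasure (GSynch_U1 l n) A)\<^sup>2 = (\<integral>\<^sup>+w. ?I w * (\<integral>\<^sup>+x. ?R x w \<partial>?X) \<partial>?G)\<^sup>2"
    by simp
  also have "\<dots> \<le> (\<integral>\<^sup>+w. ?I w ^ 2 \<partial>?G) * (\<integral>\<^sup>+w. (\<integral>\<^sup>+x. ?R x w \<partial>?X)\<^sup>2 \<partial>?G)"
    by (rule Cauchy_Schwarz_nn_integral) measurable
  also have "\<dots> \<le> emeasure (GSynch_U1 0 n) A * ennreal (1 / (1 - l\<^sup>2))"
    unfolding Q by (intro mult_left_mono likelihood_second_moment l) simp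
  finally have "ennreal ((measure (GSynch_U1 l n) A)\<^sup>2)
      \<le> ennreal (measure (GSynch_U1 0 n) A * (1 / (1 - l\<^sup>2)))"
    using l by (simp add: P.emeasure_eq_measure Q.emeasure_eq_measure ennreal_power
        ennreal_mult[symmetric] abs_square_le_1 del: times_divide_eq_right)
  then show ?thesis
    using l by (subst (asm) ennreal_le_iff) (auto simp: abs_square_le_1)
qed

theorem theorem6p11:
  fixes l :: real
  assumes "0 \<le> l" and "l < 1"
  shows "contiguous (\<lambda>n. GSynch_U1 l n) (\<lambda>n. GSynch_U1 0 n)"
  unfolding contiguous_def
proof (intro conjI allI impI)
  fix A :: "nat \<Rightarrow> cmatrix set"
  assume A: "\<forall>n. A n \<in> sets (GSynch_U1 0 n)"
    and lim: "(\<lambda>n. measure (GSynch_U1 0 n) (A n)) \<longlonglongrightarrow> 0"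
  \<comment> \<open>The factor \<open>1 / (1 - l^2)\<close> is constant in \<open>n\<close>, so
    squared probabilities are squeezed to 0; the continuous square root then removes the
    square.\<close>
  have "(\<lambda>n. (measure (GSynch_U1 l n) (A n))\<^sup>2) \<longlonglongrightarrow> 0"
  proof (rule tendsto_sandwich[where f = "\<lambda>_. 0"])
    show "(\<lambda>n. measure (GSynch_U1 0 n) (A n) * (1 / (1 - l\<^sup>2))) \<longlonglongrightarrow> 0"
      by (rule tendsto_mult_left_zero[OF lim])
    show "\<forall>\<^sub>F n in sequentially. (measure (GSynch_U1 l n) (A n))\<^sup>2
        \<le> measure (GSynch_U1 0 n) (A n) * (1 / (1 - l\<^sup>2))"
      using A by (intro always_eventually allI GSynch_U1_second_moment_bound assms) simp
  qed auto
  then show "(\<lambda>n. measure (GSynch_U1 l n) (A n)) \<longlonglongrightarrow> 0"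
    using tendsto_real_sqrt[of _ 0] by fastforce
qed (auto simp: prob_space_GSynch_U1)

end
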